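(* Let $X$ be a non-trivial complex Banach space, let $1\le p<\infty$, and let $I=\mathbb{R}$ or $I=[0,\infty)$. Then $S^pQ\text{-}AAP(I:X)\subseteq W^p_{ap}(I:X)$.
   Context: $L_S^p(I:X)$ is the space of Stepanov $p$-bounded functions: $f\in L^p_{loc}(I:X)$ with $\|f\|_{S^p}:=\sup_{t\in I}\bigl(\int_t^{t+1}\|f(s)\|^p\,ds\bigr)^{1/p}<\infty$. $S^pQ\text{-}AAP(I:X)$ (Stepanov $p$-quasi-asymptotically almost periodic functions) is the set of $f\in L_S^p(I:X)$ such that for each $\epsilon>0$ there exists a finite number $L(\epsilon)>0$ such that any interval $I'\subseteq I$ of length $L(\epsilon)$ contains at least one number $\tau\in I'$ for which there exists a finite number $M(\epsilon,\tau)>0$ with $\int_t^{t+1}\|f(s+\tau)-f(s)\|^p\,ds\le\epsilon^p$ for all $t\in I$ with $|t|\ge M(\epsilon,\tau)$. $W^p_{ap}(I:X)$ (Weyl-$p$-almost periodic functions) is the set of $f\in L^p_{loc}(I:X)$ such that for each $\epsilon>0$ there is a real number $L>0$ such that any interval $I'\subseteq I$ of length $L$ contains a point $\tau\in I'$ with $$\lim_{l\to\infty}\sup_{x\in I}\Bigl[\frac1l\int_x^{x+l}\|f(t+\tau)-f(t)\|^p\,dt\Bigr]^{1/p}\le\epsilon.$$ *)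

theory Defs
  imports "HOL-Analysis.Analysis"
begin

text \<open>
  A complex Banach space is a real one with a compatible multiplication by complex scalars; its
  norm is the given norm.
\<close>

class complex_banach = banach +
  fixes scaleC :: "complex \<Rightarrow> 'a \<Rightarrow> 'a"  (infixr "*\<^sub>C" 75)
  assumes scaleC_add_right: "c *\<^sub>C (x + y) = c *\<^sub>C x + c *\<^sub>C y"
    and scaleC_add_left: "(c + d) *\<^sub>C x = c *\<^sub>C x + d *\<^sub>C x"
    and scaleC_scaleC: "c *\<^sub>C d *\<^sub>C x = (c * d) *\<^sub>C x"
    and scaleC_one: "1 *\<^sub>C x = x"
    and scaleC_of_real: "complex_of_real r *\<^sub>C x = r *\<^sub>R x"
    and norm_scaleC: "norm (c *\<^sub>C x) = cmod c * norm x"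

instantiation complex :: complex_banach
begin

definition scaleC_complex :: "complex \<Rightarrow> complex \<Rightarrow> complex"
  where "scaleC_complex c x = c * x"

instance
  by standard (simp_all add: scaleC_complex_def algebra_simps norm_mult scaleR_conv_of_real)

end

text \<open>
  A function on \<open>I\<close> is a total function on the reals whose values off \<open>I\<close> are ignored: none of the
  notions below depends on them when \<open>I\<close> is the real line or the half-line \<open>{0..}\<close>, since then
  \<open>{t..t + l} \<subseteq> I\<close> and \<open>t + \<tau> \<in> I\<close> for \<open>t, \<tau> \<in> I\<close> and \<open>l \<ge> 0\<close>.

  Strong (Bochner) measurability. Borel measurability would be too weak for a nonseparable target
  space.
\<close>

definition strongly_measurable_on :: "real set \<Rightarrow> (real \<Rightarrow> 'a::banach) \<Rightarrow> bool"
  where "strongly_measurable_on I f \<longleftrightarrow>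
    (\<exists>s. (\<forall>n::nat. simple_function (lebesgue_on I) (s n)) \<and>
         (AE x in lebesgue_on I. (\<lambda>n. s n x) \<longlonglongrightarrow> f x))"

definition Lp_loc :: "real \<Rightarrow> real set \<Rightarrow> (real \<Rightarrow> 'a::banach) set"
  where "Lp_loc p I = {f. strongly_measurable_on I f \<and>
    (\<forall>K. compact K \<and> K \<subseteq> I \<longrightarrow> set_integrable lebesgue K (\<lambda>s. norm (f s) powr p))}"

definition stepanov_norm :: "real \<Rightarrow> real set \<Rightarrow> (real \<Rightarrow> 'a::banach) \<Rightarrow> ereal"
  where "stepanov_norm p I f =
    (SUP t\<in>I. ereal ((LINT s:{t..t + 1}|lebesgue. norm (f s) powr p) powr (1 / p)))"

definition stepanov_bounded :: "real \<Rightarrow> real set \<Rightarrow> (real \<Rightarrow> 'a::banach) set"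
  where "stepanov_bounded p I = {f \<in> Lp_loc p I. stepanov_norm p I f < \<infinity>}"

text \<open>Intervals of length \<open>L\<close> may be open, closed or half-open.\<close>

definition interval_of_length :: "real \<Rightarrow> real set \<Rightarrow> bool"
  where "interval_of_length L J \<longleftrightarrow> is_interval J \<and> emeasure lebesgue J = ennreal L"

definition stepanov_quasi_aap :: "real \<Rightarrow> real set \<Rightarrow> (real \<Rightarrow> 'a::banach) set"
  where "stepanov_quasi_aap p I = {f \<in> stepanov_bounded p I.
    \<forall>\<epsilon>>0. \<exists>L>0. \<forall>J. interval_of_length L J \<and> J \<subseteq> I \<longrightarrow>
      (\<exists>\<tau>\<in>J. \<exists>M>0. \<forall>t\<in>I. \<bar>t\<bar> \<ge> M \<longrightarrow>
        (LINT s:{t..t + 1}|lebesgue. norm (f (s + \<tau>) - f s) powr p) \<le> \<epsilon> powr p)}"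

text \<open>
  The supremum may be infinite, so the limit is taken in the extended reals; its existence is part
  of the definition.
\<close>

definition weyl_ap :: "real \<Rightarrow> real set \<Rightarrow> (real \<Rightarrow> 'a::banach) set"
  where "weyl_ap p I = {f \<in> Lp_loc p I.
    \<forall>\<epsilon>>0. \<exists>L>0. \<forall>J. interval_of_length L J \<and> J \<subseteq> I \<longrightarrow>
      (\<exists>\<tau>\<in>J. \<exists>W::ereal.
        ((\<lambda>l. SUP x\<in>I. ereal ((1 / l *
            (LINT t:{x..x + l}|lebesgue. norm (f (t + \<tau>) - f t) powr p)) powr (1 / p)))
          \<longlongrightarrow> W) at_top \<and> W \<le> ereal \<epsilon>)}"

end

theory Submission
  imports Defs
begin

text \<open>For given \<epsilon> the length \<open>L\<close> and the translation number \<tau> of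
  the Stepanov condition also serve for the Weyl condition. Put g(t) = |f(t + \<tau>) - f(t)|^p.
  Stepanov boundedness bounds the integral of g over every unit interval in \<open>I\<close> by one
  constant K, and the quasi-asymptotic condition bounds it by \<epsilon>^p once the unit interval
  starts outside (-M, M). An interval of length l is covered by at most l + 1 consecutive unit
  intervals, of which at most 2M + 1 start in (-M, M). So its integral is at most (l + 1)
  \<epsilon>^p + (2M + 1) K, uniformly in its position, and after division by l the second term
  vanishes in the limit.

  The limit has to exist as well. The supremum \<phi>(l) of the integrals over [x, x + l] is
  subadditive and increasing in l, because \<open>I\<close> is closed under adding nonnegative
  numbers; hence \<phi>(l) / l converges to its infimum
  (\<open>subadditive_mono_avg_tendsto_Inf\<close>). \<open>sup_average_tendsto\<close> joins both
  arguments and takes the power 1/p; the rest is measurability and integrability of g.\<close>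

section \<open>Measurability and size of translated differences\<close>

lemma AE_lebesgue_translate:
  fixes c :: real
  assumes "AE x in lebesgue. P x"
  shows "AE x in lebesgue. P (x + c)"
proof -
  have "lebesgue = distr lebesgue lebesgue (\<lambda>x. c + 1 * x)"
    using lebesgue_real_affine[of 1 c] by (simp add: density_1)
  with assms have "AE x in distr lebesgue lebesgue (\<lambda>x. c + 1 * x). P x"
    by metis
  moreover have "(\<lambda>x. c + 1 * x) \<in> lebesgue \<rightarrow>\<^sub>M lebesgue"
    using lebesgue_affine_measurable[of "\<lambda>_. 1" c] by simp
  ultimately have "AE x in lebesgue. P (c + 1 * x)"
    by (rule AE_distrD[rotated])
  then show ?thesis
    by (simp add: add.commute)
qed

text \<open>In a nonseparable space the difference of two Borel functions need not be Borel, so the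
  norm is taken on simple approximants, where measurability is clear, and passed to the limit.
  Translation invariance of null sets keeps the convergence at \<open>t + \<tau>\<close>.\<close>

lemma strongly_measurable_translate_diff_norm:
  fixes f :: "real \<Rightarrow> 'a::banach"
  assumes f: "strongly_measurable_on I f" and I: "I \<in> sets lebesgue"
    and shift: "\<And>t. t \<in> I \<Longrightarrow> t + \<tau> \<in> I"
  shows "(\<lambda>t. norm (f (t + \<tau>) - f t)) \<in> borel_measurable (lebesgue_on I)"
proof -
  obtain s where s: "\<And>n::nat. simple_function (lebesgue_on I) (s n)"
    and lim: "AE x in lebesgue_on I. (\<lambda>n. s n x) \<longlonglongrightarrow> f x"
    using f unfolding strongly_measurable_on_def by blast
  define h where "h n t = norm (s n (t + \<tau>) - s n t)" for n t
  have "(\<lambda>t. \<tau> + 1 * t) \<in> lebesgue \<rightarrow>\<^sub>M lebesgue"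
    using lebesgue_affine_measurable[of "\<lambda>_. 1" \<tau>] by simp
  then have "(\<lambda>t. t + \<tau>) \<in> lebesgue \<rightarrow>\<^sub>M lebesgue"
    by (simp add: add.commute)
  then have T: "(\<lambda>t. t + \<tau>) \<in> lebesgue_on I \<rightarrow>\<^sub>M lebesgue_on I"
    by (rule measurable_restrict_space3) (use shift in auto)
  have "simple_function (lebesgue_on I) (h n)" for n
    unfolding h_def
    by (rule simple_function_compose2[OF simple_function_comp[OF T s] s,
          where h = "\<lambda>a b. norm (a - b)"])
  then have [measurable]: "h n \<in> borel_measurable (lebesgue_on I)" for n
    by (rule borel_measurable_simple_function)
  have "(\<lambda>t. lim (\<lambda>n. h n t)) \<in> borel_measurable (lebesgue_on I)"
    by measurable
  \<comment> \<open>Where the approximants diverge, \<open>lim\<close> is an arbitrary value, but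
    this happens only on a null set. Extension by zero moves the claim to the whole line, where null
    sets can be translated and completeness of Lebesgue measure absorbs the exceptional set.\<close>
  then have G: "(\<lambda>t. if t \<in> I then lim (\<lambda>n. h n t) else 0) \<in> borel_measurable lebesgue"
    by (simp add: borel_measurable_if I)
  have l: "AE x in lebesgue. x \<in> I \<longrightarrow> (\<lambda>n. s n x) \<longlonglongrightarrow> f x"
    using lim I by (simp add: AE_restrict_space_iff)
  have "AE t in lebesgue. (if t \<in> I then lim (\<lambda>n. h n t) else 0)
      = (if t \<in> I then norm (f (t + \<tau>) - f t) else 0)"
    using l AE_lebesgue_translate[OF l, of \<tau>]
  proof eventually_elim
    case (elim t)
    show ?case
    proof (cases "t \<in> I")
      case True
      then have "(\<lambda>n. h n t) \<longlonglongrightarrow> norm (f (t + \<tau>) - f t)"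
        unfolding h_def using elim shift by (intro tendsto_intros) auto
      then show ?thesis
        by (simp add: limI)
    qed simp
  qed
  with G have "(\<lambda>t. if t \<in> I then norm (f (t + \<tau>) - f t) else 0) \<in> borel_measurable lebesgue"
    by (rule borel_measurable_AE)
  then show ?thesis
    using I by (simp add: borel_measurable_if)
qed

text \<open>Provides the integrable majorant of the translated difference: the norm is at most twice
  the larger of the two norms, and the power of a maximum is one of the two powers.\<close>

lemma norm_diff_powr_le:
  fixes a b :: "'a::real_normed_vector"
  assumes "0 \<le> p"
  shows "norm (a - b) powr p \<le> 2 powr p * (norm a powr p + norm b powr p)"
proof -
  have "norm (a - b) \<le> 2 * max (norm a) (norm b)"
    using norm_triangle_ineq4[of a b] by linarith
  then have "norm (a - b) powr p \<le> (2 * max (norm a) (norm b)) powr p"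
    using assms by (intro powr_mono2) auto
  also have "\<dots> = 2 powr p * max (norm a) (norm b) powr p"
    by (simp add: powr_mult)
  also have "\<dots> \<le> 2 powr p * (norm a powr p + norm b powr p)"
    by (intro mult_left_mono) (auto simp: max_def)
  finally show ?thesis .
qed

section \<open>Limits of suprema of averages\<close>

text \<open>Fekete's lemma for a real variable. Choose \<open>a\<close> with \<phi>(a) / a close to
  the infimum; monotonicity allows rounding \<open>l\<close> up to a multiple of \<open>a\<close>,
  which costs at most one extra \<phi>(a), negligible after division by \<open>l\<close>.\<close>

lemma subadditive_mono_avg_tendsto_Inf:
  fixes \<phi> :: "real \<Rightarrow> real"
  assumes subadd: "\<And>a b. 0 \<le> a \<Longrightarrow> 0 \<le> b \<Longrightarrow> \<phi> (a + b) \<le> \<phi> a + \<phi> b"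
    and mono: "\<And>a b. 0 \<le> a \<Longrightarrow> a \<le> b \<Longrightarrow> \<phi> a \<le> \<phi> b"
    and nonneg: "\<And>a. 0 \<le> a \<Longrightarrow> 0 \<le> \<phi> a"
  shows "((\<lambda>l. \<phi> l / l) \<longlongrightarrow> (INF l\<in>{0<..}. \<phi> l / l)) at_top"
proof (rule tendstoI)
  fix e :: real assume "0 < e"
  let ?A = "INF l\<in>{0<..}. \<phi> l / l"
  have bdd: "bdd_below ((\<lambda>l. \<phi> l / l) ` {0<..})"
    by (rule bdd_belowI2[where m = 0]) (simp add: nonneg)
  have "\<exists>y\<in>(\<lambda>l. \<phi> l / l) ` {0<..}. y < ?A + e / 2"
    using \<open>0 < e\<close> by (intro cInf_lessD) auto
  then obtain a where a: "0 < a" "\<phi> a / a < ?A + e / 2"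
    by auto
  \<comment> \<open>The multiples start at 1, since \<phi>(0) may be positive.\<close>
  have mult: "\<phi> (real (Suc n) * a) \<le> real (Suc n) * \<phi> a" for n
  proof (induction n)
    case (Suc n)
    have "\<phi> (real (Suc (Suc n)) * a) = \<phi> (real (Suc n) * a + a)"
      by (simp add: algebra_simps)
    also have "\<dots> \<le> \<phi> (real (Suc n) * a) + \<phi> a"
      using a by (intro subadd) auto
    finally show ?case
      using Suc by (simp add: algebra_simps)
  qed simp
  have up: "\<phi> l \<le> (l / a + 1) * \<phi> a" if "0 \<le> l" for l
  proof -
    define n where "n = nat \<lfloor>l / a\<rfloor>"
    have "0 \<le> l / a" using that a by simp
    then have n: "real n \<le> l / a" "l / a \<le> real (Suc n)"
      unfolding n_def by linarith+
    have "l \<le> real (Suc n) * a"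
      using n(2) a by (simp add: field_simps)
    then have "\<phi> l \<le> \<phi> (real (Suc n) * a)"
      using that by (intro mono)
    also have "\<dots> \<le> real (Suc n) * \<phi> a"
      by (rule mult)
    also have "\<dots> \<le> (l / a + 1) * \<phi> a"
      using n(1) nonneg[of a] a by (intro mult_right_mono) auto
    finally show ?thesis .
  qed
  show "eventually (\<lambda>l. dist (\<phi> l / l) ?A < e) at_top"
    \<comment> \<open>Beyond this threshold the rounding error \<phi>(a) / l is below e / 2; the
      choice of \<open>a\<close> accounts for the other half.\<close>
    using eventually_gt_at_top[of "max 0 (2 * \<phi> a / e)"]
  proof eventually_elim
    case (elim l)
    then have l: "0 < l" "\<phi> a / l < e / 2"
      using \<open>0 < e\<close> by (auto simp: field_simps)
    have "?A \<le> \<phi> l / l"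
      using l bdd by (intro cINF_lower) auto
    moreover have "\<phi> l / l \<le> (l / a + 1) * \<phi> a / l"
      using up[of l] l by (intro divide_right_mono) auto
    moreover have "(l / a + 1) * \<phi> a / l = \<phi> a / a + \<phi> a / l"
      using l a by (simp add: field_simps)
    ultimately show ?case
      using a l by (simp add: dist_real_def)
  qed
qed

text \<open>All such indices lie within distance 2M above the least of them, so the bound depends
  neither on \<open>x\<close> nor on \<open>n\<close>.\<close>

lemma card_nat_near_le:
  fixes x M :: real
  assumes "0 \<le> M"
  shows "card {k. k < n \<and> \<bar>x + real k\<bar> < M} \<le> nat \<lfloor>2 * M\<rfloor> + 1"
proof (cases "{k. k < n \<and> \<bar>x + real k\<bar> < M} = {}")
  case True
  show ?thesis
    unfolding True by simp
next
  case False
  let ?S = "{k. k < n \<and> \<bar>x + real k\<bar> < M}"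
  define m where "m = Min ?S"
  have m: "m \<in> ?S"
    unfolding m_def using False by (intro Min_in) auto
  have "?S \<subseteq> {m..m + nat \<lfloor>2 * M\<rfloor>}"
  proof
    fix k assume k: "k \<in> ?S"
    then have "m \<le> k"
      unfolding m_def by (intro Min_le) auto
    moreover have "real k - real m < 2 * M"
      using k m by auto
    ultimately show "k \<in> {m..m + nat \<lfloor>2 * M\<rfloor>}"
      by auto linarith
  qed
  then have "card ?S \<le> card {m..m + nat \<lfloor>2 * M\<rfloor>}"
    by (intro card_mono) auto
  then show ?thesis by simp
qed

text \<open>The power is increasing on the nonnegative reals with inverse the power 1 / r, so a real
  upper bound for the powers yields one for the values of \<open>F\<close>.\<close>

lemma SUP_ereal_powr:
  fixes F :: "'b \<Rightarrow> real"
  assumes "I \<noteq> {}" and F: "\<And>x. x \<in> I \<Longrightarrow> 0 \<le> F x" and bdd: "bdd_above (F ` I)"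
    and r: "0 < r"
  shows "(SUP x\<in>I. ereal (F x powr r)) = ereal ((SUP x\<in>I. F x) powr r)"
proof (rule SUP_eqI)
  fix x assume "x \<in> I"
  then show "ereal (F x powr r) \<le> ereal ((SUP x\<in>I. F x) powr r)"
    using F r cSUP_upper[OF _ bdd] by (auto intro!: powr_mono2)
next
  fix y assume y: "\<And>x. x \<in> I \<Longrightarrow> ereal (F x powr r) \<le> y"
  obtain x0 where x0: "x0 \<in> I" using assms(1) by blast
  show "ereal ((SUP x\<in>I. F x) powr r) \<le> y"
  proof (cases y)
    case (real z)
    have z: "F x powr r \<le> z" if "x \<in> I" for x
      using y[OF that] real by simp
    have z0: "0 \<le> z"
      using z[OF x0] powr_ge_zero[of "F x0" r] by linarith
    have "F x \<le> z powr (1 / r)" if "x \<in> I" for x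
    proof -
      have "(F x powr r) powr (1 / r) \<le> z powr (1 / r)"
        using z[OF that] r by (intro powr_mono2) auto
      then show ?thesis
        using F[OF that] r by (simp add: powr_powr)
    qed
    then have "(SUP x\<in>I. F x) \<le> z powr (1 / r)"
      using assms(1) by (intro cSUP_least) auto
    moreover have "0 \<le> (SUP x\<in>I. F x)"
      using F[OF x0] cSUP_upper[OF x0 bdd] by linarith
    ultimately have "(SUP x\<in>I. F x) powr r \<le> (z powr (1 / r)) powr r"
      using r by (intro powr_mono2) auto
    also have "\<dots> = z"
      using z0 r by (simp add: powr_powr)
    finally show ?thesis using real by simp
  qed (use y[OF x0] in auto)
qed

text \<open>
  Only boundedly many of the unit intervals that cover \<open>{x..x + l}\<close> start in \<open>{-M<..<M}\<close>; their
  contribution to the average disappears as \<open>l\<close> grows. The limit exists by Fekete's argument.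
\<close>

lemma sup_average_tendsto:
  fixes g :: "real \<Rightarrow> real"
  assumes I: "I \<noteq> {}" "\<And>x a. x \<in> I \<Longrightarrow> 0 \<le> a \<Longrightarrow> x + a \<in> I"
    and g: "\<And>t. 0 \<le> g t"
    and int: "\<And>x a. x \<in> I \<Longrightarrow> 0 \<le> a \<Longrightarrow> g integrable_on {x..x + a}"
    and K: "\<And>x. x \<in> I \<Longrightarrow> integral {x..x + 1} g \<le> K"
    and M: "0 \<le> M" "\<And>x. x \<in> I \<Longrightarrow> M \<le> \<bar>x\<bar> \<Longrightarrow> integral {x..x + 1} g \<le> \<delta>"
    and \<delta>: "0 \<le> \<delta>" and r: "0 < r"
  shows "\<exists>W. ((\<lambda>l. SUP x\<in>I. ereal ((1 / l * integral {x..x + l} g) powr r)) \<longlongrightarrow> ereal (W powr r)) at_top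
    \<and> 0 \<le> W \<and> W \<le> \<delta>"
proof -
  define G where "G x l = integral {x..x + l} g" for x l
  obtain x0 where x0: "x0 \<in> I" using I by blast
  have K0: "0 \<le> K"
    using K[OF x0] integral_nonneg[OF int[OF x0, of 1]] g by force
  have G0: "0 \<le> G x l" if "x \<in> I" "0 \<le> l" for x l
    unfolding G_def using that g int by (intro integral_nonneg) auto
  have Gadd: "G x (a + b) = G x a + G (x + a) b" if "x \<in> I" "0 \<le> a" "0 \<le> b" for x a b
    unfolding G_def
    using Henstock_Kurzweil_Integration.integral_combine[of x "x + a" "x + (a + b)" g]
      int[of x "a + b"] that by (simp add: add.assoc)
  have Gmono: "G x a \<le> G x b" if "x \<in> I" "0 \<le> a" "a \<le> b" for x a b
    using Gadd[of x a "b - a"] G0[of "x + a" "b - a"] I(2)[of x a] that by simp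
  define N where "N = real (nat \<lfloor>2 * M\<rfloor> + 1)"
  have Gnat: "G x (real n) \<le> real n * \<delta> + N * K" if x: "x \<in> I" for x n
  proof -
    have "G x (real n) = (\<Sum>k<n. G (x + real k) 1)"
    proof (induction n)
      case (Suc n)
      then show ?case
        using Gadd[of x "real n" 1] x by (simp add: add.commute)
    qed (simp add: G_def)
    \<comment> \<open>A unit interval starting far out contributes at most \<delta>; one starting
      near the origin contributes at most K, hence at most \<delta> + K.\<close>
    also have "\<dots> \<le> (\<Sum>k<n. \<delta> + (if \<bar>x + real k\<bar> < M then K else 0))"
    proof (rule sum_mono)
      fix k
      have "x + real k \<in> I" using I x by simp
      then show "G (x + real k) 1 \<le> \<delta> + (if \<bar>x + real k\<bar> < M then K else 0)"
        using K M(2) \<delta> by (fastforce simp: G_def)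
    qed
    also have "\<dots> = real n * \<delta> + real (card {k. k < n \<and> \<bar>x + real k\<bar> < M}) * K"
      by (simp add: sum.distrib sum.If_cases lessThan_def Int_def)
    also have "\<dots> \<le> real n * \<delta> + N * K"
      unfolding N_def
      by (intro add_left_mono mult_right_mono of_nat_mono card_nat_near_le M K0)
    finally show ?thesis .
  qed
  have Gbd: "G x l \<le> (l + 1) * \<delta> + N * K" if "x \<in> I" "0 \<le> l" for x l
  proof -
    have "G x l \<le> G x (real (nat \<lceil>l\<rceil>))"
      using that by (intro Gmono) linarith+
    also have "\<dots> \<le> real (nat \<lceil>l\<rceil>) * \<delta> + N * K"
      using that by (intro Gnat)
    also have "\<dots> \<le> (l + 1) * \<delta> + N * K"
      using that \<delta> by (intro add_right_mono mult_right_mono) linarith+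
    finally show ?thesis .
  qed
  define \<phi> where "\<phi> l = (SUP x\<in>I. G x l)" for l
  have bdd: "bdd_above ((\<lambda>x. G x l) ` I)" if "0 \<le> l" for l
    using Gbd that by (intro bdd_aboveI2)
  have G\<phi>: "G x l \<le> \<phi> l" if "x \<in> I" "0 \<le> l" for x l
    unfolding \<phi>_def using that bdd by (intro cSUP_upper)
  have \<phi>bd: "\<phi> l \<le> (l + 1) * \<delta> + N * K" if "0 \<le> l" for l
    unfolding \<phi>_def using that Gbd I by (intro cSUP_least) auto
  have \<phi>0: "0 \<le> \<phi> l" if "0 \<le> l" for l
    using G0[OF x0 that] G\<phi>[OF x0 that] by linarith
  have \<phi>lim: "((\<lambda>l. \<phi> l / l) \<longlongrightarrow> (INF l\<in>{0<..}. \<phi> l / l)) at_top"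
  proof (rule subadditive_mono_avg_tendsto_Inf)
    fix a b :: real assume ab: "0 \<le> a" "0 \<le> b"
    \<comment> \<open>The interval splits at \<open>x + a\<close>, which is again in
      \<open>I\<close>, so each piece is bounded by its own supremum.\<close>
    have "G x (a + b) \<le> \<phi> a + \<phi> b" if x: "x \<in> I" for x
      using Gadd[OF x ab] G\<phi>[OF x ab(1)] G\<phi>[OF I(2)[OF x ab(1)] ab(2)] by linarith
    then show "\<phi> (a + b) \<le> \<phi> a + \<phi> b"
      unfolding \<phi>_def[of "a + b"] using I(1) by (intro cSUP_least) auto
  next
    fix a b :: real assume ab: "0 \<le> a" "a \<le> b"
    have "G x a \<le> \<phi> b" if x: "x \<in> I" for x
      using Gmono[OF x ab] G\<phi>[OF x, of b] ab by linarith
    then show "\<phi> a \<le> \<phi> b"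
      unfolding \<phi>_def[of a] using I(1) by (intro cSUP_least) auto
  qed (rule \<phi>0)
  define W where "W = (INF l\<in>{0<..}. \<phi> l / l)"
  have "0 \<le> W"
    unfolding W_def using \<phi>0 by (intro cINF_greatest) auto
  have "W \<le> \<delta>"
  proof (rule tendsto_le[OF _ _ \<phi>lim[folded W_def]])
    have "((\<lambda>l. \<delta> + (\<delta> + N * K) / l) \<longlongrightarrow> \<delta> + 0) at_top"
      by (intro tendsto_intros tendsto_divide_0[OF tendsto_const]
          filterlim_at_top_imp_at_infinity filterlim_ident)
    then show "((\<lambda>l. \<delta> + (\<delta> + N * K) / l) \<longlongrightarrow> \<delta>) at_top"
      by simp
    show "\<forall>\<^sub>F l in at_top. \<phi> l / l \<le> \<delta> + (\<delta> + N * K) / l"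
      using eventually_gt_at_top[of "0::real"]
    proof eventually_elim
      case (elim l)
      then show ?case
        using \<phi>bd[of l] by (simp add: field_simps)
    qed
  qed simp
  have "\<forall>\<^sub>F l in at_top. ereal ((\<phi> l / l) powr r)
      = (SUP x\<in>I. ereal ((1 / l * integral {x..x + l} g) powr r))"
    using eventually_gt_at_top[of "0::real"]
  proof eventually_elim
    case (elim l)
    have b: "1 / l * G x l \<le> \<phi> l / l" if "x \<in> I" for x
      using G\<phi>[OF that, of l] elim by (simp add: field_simps)
    have "(SUP x\<in>I. 1 / l * G x l) = \<phi> l / l"
    proof (rule antisym)
      show "(SUP x\<in>I. 1 / l * G x l) \<le> \<phi> l / l"
        using I(1) b by (intro cSUP_least)
      have "G x l \<le> l * (SUP x\<in>I. 1 / l * G x l)" if "x \<in> I" for x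
        using cSUP_upper[OF that bdd_aboveI2[OF b]] elim by (simp add: field_simps)
      then have "\<phi> l \<le> l * (SUP x\<in>I. 1 / l * G x l)"
        unfolding \<phi>_def using I(1) by (intro cSUP_least)
      then show "\<phi> l / l \<le> (SUP x\<in>I. 1 / l * G x l)"
        using elim by (simp add: field_simps)
    qed
    moreover have "(SUP x\<in>I. ereal ((1 / l * G x l) powr r))
        = ereal ((SUP x\<in>I. 1 / l * G x l) powr r)"
      using I(1) r G0 elim by (intro SUP_ereal_powr bdd_aboveI2[OF b]) auto
    ultimately show ?case
      by (simp add: G_def)
  qed
  moreover have "((\<lambda>l. ereal ((\<phi> l / l) powr r)) \<longlongrightarrow> ereal (W powr r)) at_top"
  proof (intro tendsto_ereal tendsto_powr'[OF \<phi>lim[folded W_def] tendsto_const])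
    \<comment> \<open>If W = 0, the limit of the powers rests on r > 0 and on the averages being
      nonnegative.\<close>
    have "\<forall>\<^sub>F l in at_top. 0 \<le> \<phi> l / l"
      using eventually_gt_at_top[of "0::real"]
      by (rule eventually_mono) (simp add: \<phi>0)
    with r show "W \<noteq> 0 \<or> 0 < r \<and> (\<forall>\<^sub>F l in at_top. 0 \<le> \<phi> l / l)"
      by blast
  qed
  ultimately have "((\<lambda>l. SUP x\<in>I. ereal ((1 / l * integral {x..x + l} g) powr r))
      \<longlongrightarrow> ereal (W powr r)) at_top"
    by (rule Lim_transform_eventually[rotated])
  with \<open>0 \<le> W\<close> \<open>W \<le> \<delta>\<close> show ?thesis by blast
qed

section \<open>From Stepanov bounds to the inclusion\<close>

text \<open>A finite extended-real supremum bounds the p-th roots by a real number; raising to the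
  power \<open>p\<close> removes the roots.\<close>

lemma stepanov_bounded_integral_le:
  fixes f :: "real \<Rightarrow> 'a::banach"
  assumes f: "f \<in> stepanov_bounded p I" and p: "0 < p"
  obtains C where "\<And>t. t \<in> I \<Longrightarrow> (LINT s:{t..t + 1}|lebesgue. norm (f s) powr p) \<le> C"
proof -
  have "stepanov_norm p I f < \<infinity>"
    using f by (simp add: stepanov_bounded_def)
  then obtain c where c: "stepanov_norm p I f < ereal c"
    using ereal_dense2 by blast
  have "(LINT s:{t..t + 1}|lebesgue. norm (f s) powr p) \<le> c powr p" if "t \<in> I" for t
  proof -
    let ?i = "LINT s:{t..t + 1}|lebesgue. norm (f s) powr p"
    have i0: "0 \<le> ?i"
      unfolding set_lebesgue_integral_def by (intro integral_nonneg_AE) auto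
    have "ereal (?i powr (1 / p)) \<le> stepanov_norm p I f"
      unfolding stepanov_norm_def using that by (rule SUP_upper)
    with c have "ereal (?i powr (1 / p)) \<le> ereal c"
      by (meson le_less_trans less_imp_le)
    then have "(?i powr (1 / p)) powr p \<le> c powr p"
      using p by (intro powr_mono2) auto
    then show ?thesis
      using p i0 by (simp add: powr_powr)
  qed
  then show ?thesis by (rule that)
qed

theorem proposition2p12:
  fixes p :: real and I :: "real set"
  assumes "\<exists>x::'a::complex_banach. x \<noteq> 0"
    and "1 \<le> p"
    and "I = UNIV \<or> I = {0..}"
  shows "(stepanov_quasi_aap p I :: (real \<Rightarrow> 'a) set) \<subseteq> weyl_ap p I"
proof
  fix f :: "real \<Rightarrow> 'a" assume fq: "f \<in> stepanov_quasi_aap p I"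
  then have fb: "f \<in> stepanov_bounded p I"
    by (simp add: stepanov_quasi_aap_def)
  then have fl: "f \<in> Lp_loc p I"
    by (simp add: stepanov_bounded_def)
  have I0: "I \<noteq> {}" and Iadd: "\<And>x a. x \<in> I \<Longrightarrow> 0 \<le> a \<Longrightarrow> x + a \<in> I"
    and Icc: "\<And>x y. x \<in> I \<Longrightarrow> {x..y} \<subseteq> I" and Imeas: "I \<in> sets lebesgue"
    and Ishift: "\<And>x a. x \<in> I \<Longrightarrow> a \<in> I \<Longrightarrow> x + a \<in> I"
    using assms(3) by auto
  have p: "0 < p" using assms(2) by simp
  have fset: "set_integrable lebesgue {x..y} (\<lambda>s. norm (f s) powr p)" if "x \<in> I" for x y
    using fl Icc[OF that] by (auto simp: Lp_loc_def)
  define P where "P s = norm (f s) powr p" for s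
  have Pint: "P integrable_on {x..y}" if "x \<in> I" for x y
    using set_lebesgue_integral_eq_integral(1)[OF fset[OF that]] by (simp add: P_def[abs_def])
  obtain C where C: "integral {t..t + 1} P \<le> C" if "t \<in> I" for t
    using stepanov_bounded_integral_le[OF fb p] set_lebesgue_integral_eq_integral(2)[OF fset]
    unfolding P_def[abs_def] by metis
  show "f \<in> weyl_ap p I"
    unfolding weyl_ap_def
  proof (intro CollectI conjI allI impI fl)
    fix \<epsilon> :: real assume \<epsilon>: "0 < \<epsilon>"
    from fq \<epsilon> obtain L where L: "L > 0"
      and LJ: "\<And>J. interval_of_length L J \<and> J \<subseteq> I \<Longrightarrow>
        \<exists>\<tau>\<in>J. \<exists>M>0. \<forall>t\<in>I. \<bar>t\<bar> \<ge> M \<longrightarrow>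
          (LINT s:{t..t + 1}|lebesgue. norm (f (s + \<tau>) - f s) powr p) \<le> \<epsilon> powr p"
      unfolding stepanov_quasi_aap_def by blast
    have "\<exists>\<tau>\<in>J. \<exists>W::ereal.
        ((\<lambda>l. SUP x\<in>I. ereal ((1 / l *
            (LINT t:{x..x + l}|lebesgue. norm (f (t + \<tau>) - f t) powr p)) powr (1 / p)))
          \<longlongrightarrow> W) at_top \<and> W \<le> ereal \<epsilon>"
      if J: "interval_of_length L J \<and> J \<subseteq> I" for J
    proof -
      from LJ[OF J] obtain \<tau> M where \<tau>: "\<tau> \<in> J" and M: "M > 0"
        and small: "\<And>t. t \<in> I \<Longrightarrow> \<bar>t\<bar> \<ge> M \<Longrightarrow>
          (LINT s:{t..t + 1}|lebesgue. norm (f (s + \<tau>) - f s) powr p) \<le> \<epsilon> powr p"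
        by blast
      have \<tau>I: "\<tau> \<in> I" using \<tau> J by blast
      define g where "g t = norm (f (t + \<tau>) - f t) powr p" for t
      define B where "B t = 2 powr p * (P (t + \<tau>) + P t)" for t
      have "(\<lambda>t. norm (f (t + \<tau>) - f t)) \<in> borel_measurable (lebesgue_on I)"
        using fl Imeas Ishift[OF _ \<tau>I]
        by (intro strongly_measurable_translate_diff_norm) (auto simp: Lp_loc_def)
      then have gI: "g \<in> borel_measurable (lebesgue_on I)"
        unfolding g_def[abs_def] by measurable
      have gB: "norm (g t) \<le> B t" for t
        unfolding g_def B_def P_def using norm_diff_powr_le[of p] p by simp
      have Pshift: "(\<lambda>t. P (t + \<tau>)) integrable_on {x..y}" if "x \<in> I" for x y
        using integrable_shift_real_ivl[OF Pint[OF Ishift[OF that \<tau>I], of "y + \<tau>"], of \<tau>] by simp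
      have Bint: "B integrable_on {x..y}" if "x \<in> I" for x y
        unfolding B_def[abs_def] using Pshift[OF that] Pint[OF that]
        by (intro integrable_on_mult_right integrable_add)
      \<comment> \<open>Absolute integrability makes the Lebesgue integral of the definitions agree
        with the gauge integral of \<open>sup_average_tendsto\<close>. It follows from measurability
        and the majorant \<open>B\<close>.\<close>
      have gabs: "g absolutely_integrable_on {x..y}" if "x \<in> I" for x y
      proof (rule measurable_bounded_by_integrable_imp_absolutely_integrable[OF _ _ Bint[OF that] gB])
        show "g \<in> borel_measurable (lebesgue_on {x..y})"
          using gI Icc[OF that] by (rule measurable_restrict_mono)
      qed auto
      have gint: "g integrable_on {x..y}"
        and geq: "(LINT t:{x..y}|lebesgue. norm (f (t + \<tau>) - f t) powr p) = integral {x..y} g"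
        if "x \<in> I" for x y
        using set_lebesgue_integral_eq_integral[OF gabs[OF that]] by (simp_all add: g_def[abs_def])
      \<comment> \<open>One \<open>C\<close> bounds the unit integral of \<open>P\<close> at
        \<open>x\<close>, the other the one at \<open>x + \<tau>\<close>, which lies in
        \<open>I\<close> because \<tau> does.\<close>
      have "integral {x..x + 1} g \<le> 2 powr p * (C + C)" if "x \<in> I" for x
      proof -
        have "integral {x..x + 1} g \<le> integral {x..x + 1} B"
          using gint[OF that] Bint[OF that] gB by (intro integral_le) (auto simp: abs_le_iff)
        also have "\<dots> = 2 powr p * (integral {x..x + 1} (\<lambda>t. P (t + \<tau>)) + integral {x..x + 1} P)"
          unfolding B_def[abs_def] using Pshift[OF that] Pint[OF that]
          by (simp add: Henstock_Kurzweil_Integration.integral_add)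
        also have "integral {x..x + 1} (\<lambda>t. P (t + \<tau>)) = integral {x + \<tau>..x + \<tau> + 1} P"
          using integral_shift_real_ivl[of "x + \<tau>" \<tau> "x + \<tau> + 1" P] by (simp add: algebra_simps)
        finally show ?thesis
          using C[OF that] C[OF Ishift[OF that \<tau>I]]
          by (smt (verit) mult_left_mono powr_ge_zero)
      qed
      \<comment> \<open>Here \<delta> is \<open>\<epsilon> powr p\<close> and the exponent is 1 / p,
        so the root of \<open>W\<close> is at most \<epsilon>.\<close>
      then obtain W where lim: "((\<lambda>l. SUP x\<in>I. ereal ((1 / l * integral {x..x + l} g) powr (1 / p)))
          \<longlongrightarrow> ereal (W powr (1 / p))) at_top" and W: "0 \<le> W" "W \<le> \<epsilon> powr p"
        using sup_average_tendsto[of I g "2 powr p * (C + C)" M "\<epsilon> powr p" "1 / p"]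
          I0 Iadd gint geq small M p by (auto simp: g_def)
      have "W powr (1 / p) \<le> (\<epsilon> powr p) powr (1 / p)"
        using W p by (intro powr_mono2) auto
      also have "\<dots> = \<epsilon>"
        using \<epsilon> p by (simp add: powr_powr)
      finally show ?thesis
        using \<tau> lim by (intro bexI[of _ \<tau>] exI[of _ "ereal (W powr (1 / p))"])
          (auto simp: geq cong: SUP_cong)
    qed
    with L show "\<exists>L>0. \<forall>J. interval_of_length L J \<and> J \<subseteq> I \<longrightarrow>
      (\<exists>\<tau>\<in>J. \<exists>W::ereal.
        ((\<lambda>l. SUP x\<in>I. ereal ((1 / l *
            (LINT t:{x..x + l}|lebesgue. norm (f (t + \<tau>) - f t) powr p)) powr (1 / p)))
          \<longlongrightarrow> W) at_top \<and> W \<le> ereal \<epsilon>)"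
      by blast
  qed
qed

end
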